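(* Let $\Omega\subset\mathbb{C}$ be a bounded simply-connected domain, let $\psi:\mathbb{D}\to\Omega$ be a Riemann map (a biholomorphism from the open unit disc $\mathbb{D}$ onto $\Omega$), and let $o=\psi(0)$. Then the following are equivalent: (i) for every $x\in\partial\Omega$ and every $R>0$, $\overline{H^s_o(x,R)}\cap\partial\Omega=\overline{H^b_o(x,R)}\cap\partial\Omega=\{x\}$; (ii) $\psi$ extends to a homeomorphism from $\overline{\mathbb{D}}$ onto $\overline{\Omega}$, i.e. $\Omega$ is a Jordan domain.
   Context: For a Kobayashi hyperbolic domain $\Omega\subset\mathbb{C}^d$ with Kobayashi distance $\mathsf{k}_\Omega$, a point $x\in\partial\Omega$ (boundary in $\mathbb{C}^d$), a pole $o\in\Omega$ and $R>0$, the small horosphere and big horosphere are $H^s_o(x,R)=\{z\in\Omega:\limsup_{w\to x}(\mathsf{k}_\Omega(z,w)-\mathsf{k}_\Omega(o,w))<\tfrac12\log R\}$, $H^b_o(x,R)=\{z\in\Omega:\liminf_{w\to x}(\mathsf{k}_\Omega(z,w)-\mathsf{k}_\Omega(o,w))<\tfrac12\log R\}$, where $w$ ranges over $\Omega$. Closures are taken in $\mathbb{C}^d$. *)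

theory Defs
  imports "HOL-Complex_Analysis.Complex_Analysis" "HOL-Library.Liminf_Limsup"
begin

text \<open>Poincare (Kobayashi) distance on the unit disc, normalised so that
  the distance from 0 to z is artanh |z| = (1/2) log((1+|z|)/(1-|z|)).\<close>
definition poincare_dist :: "complex \<Rightarrow> complex \<Rightarrow> real" where
  "poincare_dist a b = artanh (cmod (a - b) / cmod (1 - cnj a * b))"

definition kobayashi_dist :: "complex set \<Rightarrow> complex \<Rightarrow> complex \<Rightarrow> real" where
  "kobayashi_dist \<Omega> z w = Inf {(\<Sum>i<n. poincare_dist (a i) (b i)) | n p a b f.
      p 0 = z \<and> p n = w \<and>
      (\<forall>i<n. f i holomorphic_on ball 0 1 \<and> f i ` ball 0 1 \<subseteq> \<Omega> \<and>
              a i \<in> ball 0 1 \<and> b i \<in> ball 0 1 \<and>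
              f i (a i) = p i \<and> f i (b i) = p (Suc i))}"

definition small_horosphere :: "complex set \<Rightarrow> complex \<Rightarrow> complex \<Rightarrow> real \<Rightarrow> complex set" where
  "small_horosphere \<Omega> p0 x R = {z \<in> \<Omega>.
     Limsup (at x within \<Omega>) (\<lambda>w. ereal (kobayashi_dist \<Omega> z w - kobayashi_dist \<Omega> p0 w))
       < ereal (ln R / 2)}"

definition big_horosphere :: "complex set \<Rightarrow> complex \<Rightarrow> complex \<Rightarrow> real \<Rightarrow> complex set" where
  "big_horosphere \<Omega> p0 x R = {z \<in> \<Omega>.
     Liminf (at x within \<Omega>) (\<lambda>w. ereal (kobayashi_dist \<Omega> z w - kobayashi_dist \<Omega> p0 w))
       < ereal (ln R / 2)}"

end

theory Submission
  imports Defs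
begin

text \<open>By the Schwarz--Pick lemma and the triangle inequality, the inverse \<open>\<phi>\<close> of the Riemann map
  carries the Kobayashi distance to the Poincare distance. Hence if \<open>\<phi> w\<close> tends to a point \<open>\<sigma>\<close> of
  the unit circle, the difference of the distances from \<open>w\<close> to \<open>z\<close> and to the pole tends to the
  horofunction of the disc at \<open>\<sigma>\<close>, evaluated at \<open>\<phi> z\<close>. If \<open>\<phi>\<close> extends to a homeomorphism of the
  closures, both horospheres are therefore preimages of one horodisc, whose closure meets the circle
  only at \<open>\<sigma>\<close>.

  Conversely, consider the closure of the graph of \<open>\<phi>\<close>, a compact set. Its fibre over a frontier
  point \<open>x\<close> is the set of cluster values of \<open>\<phi>\<close> at \<open>x\<close>; a point of the small horosphere of
  parameter \<open>R\<close> is mapped within distance \<open>sqrt R\<close> of each of them, so nonempty small horospheres for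
  all \<open>R\<close> leave only one cluster value. If two frontier points had the same cluster value, both big
  horospheres would contain the preimage of one horodisc, which accumulates at some frontier point,
  so the two points coincide. Both coordinate projections of the compact graph closure are thus
  injective, hence homeomorphisms.\<close>

section \<open>The Poincare distance\<close>

text \<open>This identity turns bounds on Moebius quotients into bounds on
  \<open>cmod (1 - cnj a * b)\<close>. When one point lies on the unit circle, it makes the two
  moduli equal.\<close>

lemma norm_one_minus_cnj_mult_diff:
  fixes a b :: complex
  shows "(cmod (1 - cnj a * b))\<^sup>2 - (cmod (a - b))\<^sup>2 = (1 - (cmod a)\<^sup>2) * (1 - (cmod b)\<^sup>2)"
  unfolding cmod_power2 by (simp add: power2_eq_square) algebra

text \<open>Modulus 1 is allowed for \<open>b\<close> because limits at points of the unit circle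
  are taken later.\<close>

lemma one_minus_cnj_mult_nonzero:
  fixes a b :: complex
  assumes "cmod a < 1" "cmod b \<le> 1"
  shows "1 - cnj a * b \<noteq> 0"
proof
  assume "1 - cnj a * b = 0"
  then have "cmod a * cmod b = 1"
    by (metis complex_mod_cnj eq_iff_diff_eq_0 norm_mult norm_one)
  moreover have "cmod a * cmod b \<le> cmod a * 1"
    using assms by (intro mult_left_mono) auto
  ultimately show False using assms by simp
qed

lemma Moebius_function_0_eq: "cmod (Moebius_function 0 a b) = cmod (a - b) / cmod (1 - cnj a * b)"
  by (simp add: Moebius_function_simple norm_divide norm_minus_commute)

lemma poincare_dist_eq_Moebius: "poincare_dist a b = artanh (cmod (Moebius_function 0 a b))"
  by (simp add: poincare_dist_def Moebius_function_0_eq)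

lemma norm_Moebius_function_commute:
  "cmod (Moebius_function 0 a b) = cmod (Moebius_function 0 b a)"
proof -
  have "cmod (1 - cnj a * b) = cmod (cnj (1 - cnj a * b))"
    by (simp only: complex_mod_cnj)
  then show ?thesis
    by (simp add: Moebius_function_0_eq norm_minus_commute mult.commute)
qed

lemma one_minus_norm_Moebius_power2:
  assumes "cmod a < 1" "cmod b < 1"
  shows "1 - (cmod (Moebius_function 0 a b))\<^sup>2
    = (1 - (cmod a)\<^sup>2) * (1 - (cmod b)\<^sup>2) / (cmod (1 - cnj a * b))\<^sup>2"
  unfolding norm_one_minus_cnj_mult_diff[symmetric]
  using one_minus_cnj_mult_nonzero[of a b] assms
  by (simp add: Moebius_function_0_eq power_divide diff_divide_distrib)

text \<open>Precomposing with the Moebius map that sends 0 to \<open>a\<close>, and postcomposing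
  with the one that sends \<open>g a\<close> to 0, gives a self-map of the disc fixing 0. The
  Schwarz lemma applies to it at the point \<open>?M a b\<close>.\<close>

lemma Schwarz_Pick:
  assumes hol: "g holomorphic_on ball 0 1" and sub: "g ` ball 0 1 \<subseteq> ball 0 1"
    and a: "cmod a < 1" and b: "cmod b < 1"
  shows "cmod (Moebius_function 0 (g a) (g b)) \<le> cmod (Moebius_function 0 a b)"
proof -
  let ?M = "Moebius_function 0"
  have g: "cmod (g z) < 1" if "cmod z < 1" for z
    using sub that by force
  have Ma: "cmod (?M (-a) z) < 1" if "cmod z < 1" for z
    using a that by (simp add: Moebius_function_norm_lt_1)
  have "(?M (g a) \<circ> (g \<circ> ?M (-a))) holomorphic_on ball 0 1"
  proof (rule holomorphic_on_compose_gen[where t = "ball 0 1"])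
    show "g \<circ> ?M (-a) holomorphic_on ball 0 1"
      by (rule holomorphic_on_compose_gen[OF Moebius_function_holomorphic hol])
        (use a Ma in auto)
    show "?M (g a) holomorphic_on ball 0 1"
      using g[OF a] by (rule Moebius_function_holomorphic)
  qed (use g Ma in auto)
  then have "cmod ((?M (g a) \<circ> (g \<circ> ?M (-a))) (?M a b)) \<le> cmod (?M a b)"
    by (rule Schwarz_Lemma)
       (use a b g Ma in \<open>auto simp: Moebius_function_of_zero Moebius_function_eq_zero
          intro!: Moebius_function_norm_lt_1\<close>)
  moreover have "?M (-a) (?M a b) = b"
    using Moebius_function_compose[of "-a" a b] a b by simp
  ultimately show ?thesis by simp
qed

text \<open>Schwarz-Pick is applied to the Moebius map of parameter \<open>c\<close> and to its
  inverse, of parameter \<open>-c\<close>.\<close>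

lemma norm_Moebius_invariant:
  assumes "cmod a < 1" "cmod b < 1" "cmod c < 1"
  shows "cmod (Moebius_function 0 (Moebius_function 0 c a) (Moebius_function 0 c b))
    = cmod (Moebius_function 0 a b)"
proof (rule antisym)
  let ?M = "Moebius_function 0"
  have hol: "?M d holomorphic_on ball 0 1" "?M d ` ball 0 1 \<subseteq> ball 0 1" if "cmod d < 1" for d
    using that Moebius_function_holomorphic Moebius_function_norm_lt_1 by auto
  show "cmod (?M (?M c a) (?M c b)) \<le> cmod (?M a b)"
    using hol assms by (intro Schwarz_Pick) auto
  have "cmod (?M (?M (-c) (?M c a)) (?M (-c) (?M c b))) \<le> cmod (?M (?M c a) (?M c b))"
    using hol[of "-c"] assms by (intro Schwarz_Pick) (auto intro: Moebius_function_norm_lt_1)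
  then show "cmod (?M a b) \<le> cmod (?M (?M c a) (?M c b))"
    using Moebius_function_compose[of "-c" c] assms by simp
qed

lemma artanh_mono:
  fixes x y :: real
  assumes "0 \<le> x" "x \<le> y" "y < 1"
  shows "artanh x \<le> artanh y"
  using assms by (auto simp: artanh_def intro!: frac_le)

lemma artanh_add:
  fixes x y :: real
  assumes "0 \<le> x" "x < 1" "0 \<le> y" "y < 1"
  shows "artanh x + artanh y = artanh ((x + y) / (1 + x * y))"
proof -
  have 1: "1 + x * y > 0" using assms by (simp add: add_pos_nonneg)
  have "1 + (x + y) / (1 + x * y) = (1 + x) * (1 + y) / (1 + x * y)"
       "1 - (x + y) / (1 + x * y) = (1 - x) * (1 - y) / (1 + x * y)"
    using 1 by (simp_all add: field_simps)
  then have eq: "(1 + (x + y) / (1 + x * y)) / (1 - (x + y) / (1 + x * y))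
      = ((1 + x) / (1 - x)) * ((1 + y) / (1 - y))"
    using 1 by simp
  have ln: "ln (((1 + x) / (1 - x)) * ((1 + y) / (1 - y))) = ln ((1 + x) / (1 - x)) + ln ((1 + y) / (1 - y))"
    using assms by (intro ln_mult_pos) auto
  show ?thesis
    unfolding artanh_def eq ln by (rule add_divide_distrib[symmetric])
qed

text \<open>Writing 1 minus the square of either side as a fraction gives the same numerator, so
  only the denominators need comparing: \<open>cmod (1 - cnj u * v)\<close> is at most
  \<open>1 + cmod u * cmod v\<close>. By \<open>artanh_add\<close> this is the triangle inequality
  through 0.\<close>

lemma norm_Moebius_le:
  assumes u: "cmod u < 1" and v: "cmod v < 1"
  shows "cmod (Moebius_function 0 u v) \<le> (cmod u + cmod v) / (1 + cmod u * cmod v)"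
proof -
  have pos: "0 < 1 + cmod u * cmod v" by (simp add: add_pos_nonneg)
  have le: "cmod (1 - cnj u * v) \<le> 1 + cmod u * cmod v"
    using norm_triangle_ineq4[of 1 "cnj u * v"] by (simp add: norm_mult)
  have "1 - ((cmod u + cmod v) / (1 + cmod u * cmod v))\<^sup>2
      = (1 - (cmod u)\<^sup>2) * (1 - (cmod v)\<^sup>2) / (1 + cmod u * cmod v)\<^sup>2"
    using pos by (simp add: power_divide divide_simps) algebra
  also have "\<dots> \<le> (1 - (cmod u)\<^sup>2) * (1 - (cmod v)\<^sup>2) / (cmod (1 - cnj u * v))\<^sup>2"
    using le one_minus_cnj_mult_nonzero[of u v] u v pos
    by (intro divide_left_mono mult_nonneg_nonneg mult_pos_pos power_mono)
       (auto simp: power_le_one abs_square_le_1 simp del: mult_pos_pos)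
  also have "\<dots> = 1 - (cmod (Moebius_function 0 u v))\<^sup>2"
    using one_minus_norm_Moebius_power2[OF u v] by simp
  finally have "(cmod (Moebius_function 0 u v))\<^sup>2 \<le> ((cmod u + cmod v) / (1 + cmod u * cmod v))\<^sup>2"
    by simp
  then show ?thesis
    by (rule power2_le_imp_le) simp
qed

lemma poincare_dist_refl [simp]: "poincare_dist a a = 0"
  by (simp add: poincare_dist_def)

text \<open>By invariance the middle point \<open>b\<close> may be moved to 0, where
  \<open>norm_Moebius_le\<close> and \<open>artanh_add\<close> apply.\<close>

lemma poincare_dist_triangle:
  assumes a: "cmod a < 1" and b: "cmod b < 1" and c: "cmod c < 1"
  shows "poincare_dist a c \<le> poincare_dist a b + poincare_dist b c"
proof -
  let ?u = "Moebius_function 0 b a" and ?v = "Moebius_function 0 b c"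
  have uv: "cmod ?u < 1" "cmod ?v < 1"
    using assms by (auto intro: Moebius_function_norm_lt_1)
  have "(1 - cmod ?u) * (1 - cmod ?v) > 0"
    using uv by simp
  then have lt1: "(cmod ?u + cmod ?v) / (1 + cmod ?u * cmod ?v) < 1"
    by (simp add: add_pos_nonneg algebra_simps)
  have "poincare_dist a c = artanh (cmod (Moebius_function 0 ?u ?v))"
    using norm_Moebius_invariant[OF a c b] by (simp add: poincare_dist_eq_Moebius)
  also have "\<dots> \<le> artanh ((cmod ?u + cmod ?v) / (1 + cmod ?u * cmod ?v))"
    using lt1 by (intro artanh_mono norm_Moebius_le uv) auto
  also have "\<dots> = poincare_dist a b + poincare_dist b c"
    using uv norm_Moebius_function_commute[of a b]
    by (simp add: artanh_add poincare_dist_eq_Moebius)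
  finally show ?thesis .
qed

lemma poincare_dist_contraction:
  assumes "g holomorphic_on ball 0 1" "g ` ball 0 1 \<subseteq> ball 0 1" "cmod a < 1" "cmod b < 1"
  shows "poincare_dist (g a) (g b) \<le> poincare_dist a b"
  unfolding poincare_dist_eq_Moebius
  using assms by (intro artanh_mono Schwarz_Pick Moebius_function_norm_lt_1) auto

lemma poincare_dist_chain:
  assumes "\<And>i. i \<le> n \<Longrightarrow> cmod (q i) < 1"
  shows "poincare_dist (q 0) (q n) \<le> (\<Sum>i<n. poincare_dist (q i) (q (Suc i)))"
  using assms
proof (induction n)
  case (Suc n)
  then have "poincare_dist (q 0) (q (Suc n)) \<le> poincare_dist (q 0) (q n) + poincare_dist (q n) (q (Suc n))"
    by (intro poincare_dist_triangle) auto
  with Suc show ?case by fastforce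
qed simp

text \<open>The infimum is attained by the single disc \<psi>. Conversely, \<phi> turns each disc of
  a chain into a self-map of the unit disc, which contracts, and the triangle inequality adds up the
  links.\<close>

lemma kobayashi_dist_eq_poincare_dist:
  assumes hol\<psi>: "\<psi> holomorphic_on ball 0 1" and im: "\<psi> ` ball 0 1 = \<Omega>"
    and hol\<phi>: "\<phi> holomorphic_on \<Omega>" and \<phi>\<psi>: "\<And>\<xi>. cmod \<xi> < 1 \<Longrightarrow> \<phi> (\<psi> \<xi>) = \<xi>"
    and z: "z \<in> \<Omega>" and w: "w \<in> \<Omega>"
  shows "kobayashi_dist \<Omega> z w = poincare_dist (\<phi> z) (\<phi> w)"
  unfolding kobayashi_dist_def
proof (rule cInf_eq_minimum)
  have \<phi>: "cmod (\<phi> u) < 1" "\<psi> (\<phi> u) = u" if "u \<in> \<Omega>" for u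
    using that im \<phi>\<psi> by auto
  show "poincare_dist (\<phi> z) (\<phi> w) \<in> {(\<Sum>i<n. poincare_dist (a i) (b i)) | n p a b f.
      p 0 = z \<and> p n = w \<and>
      (\<forall>i<n. f i holomorphic_on ball 0 1 \<and> f i ` ball 0 1 \<subseteq> \<Omega> \<and>
              a i \<in> ball 0 1 \<and> b i \<in> ball 0 1 \<and>
              f i (a i) = p i \<and> f i (b i) = p (Suc i))}"
    unfolding mem_Collect_eq
    \<comment> \<open>A chain with one link, from \<open>z\<close> at index 0 to \<open>w\<close> at
      index 1.\<close>
    by (rule exI[of _ "Suc 0"], rule exI[of _ "\<lambda>i. if i = 0 then z else w"],
        rule exI[of _ "\<lambda>_. \<phi> z"], rule exI[of _ "\<lambda>_. \<phi> w"], rule exI[of _ "\<lambda>_. \<psi>"])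
       (use hol\<psi> im \<phi> z w in auto)
next
  fix s
  assume "s \<in> {(\<Sum>i<n. poincare_dist (a i) (b i)) | n p a b f.
      p 0 = z \<and> p n = w \<and>
      (\<forall>i<n. f i holomorphic_on ball 0 1 \<and> f i ` ball 0 1 \<subseteq> \<Omega> \<and>
              a i \<in> ball 0 1 \<and> b i \<in> ball 0 1 \<and>
              f i (a i) = p i \<and> f i (b i) = p (Suc i))}"
  then obtain n p a b f where s: "s = (\<Sum>i<n. poincare_dist (a i) (b i))"
    and p: "p 0 = z" "p n = w"
    and f: "\<And>i. i < n \<Longrightarrow> f i holomorphic_on ball 0 1" "\<And>i. i < n \<Longrightarrow> f i ` ball 0 1 \<subseteq> \<Omega>"
    and ab: "\<And>i. i < n \<Longrightarrow> cmod (a i) < 1" "\<And>i. i < n \<Longrightarrow> cmod (b i) < 1"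
      "\<And>i. i < n \<Longrightarrow> f i (a i) = p i" "\<And>i. i < n \<Longrightarrow> f i (b i) = p (Suc i)"
    unfolding mem_Collect_eq mem_ball_0 by (elim exE conjE) blast
  have \<phi>: "cmod (\<phi> u) < 1" if "u \<in> \<Omega>" for u
    using that im \<phi>\<psi> by auto
  \<comment> \<open>The discs have indices below \<open>n\<close>, so the last point is treated
    separately, through \<open>p n = w\<close>.\<close>
  have p\<Omega>: "p i \<in> \<Omega>" if "i \<le> n" for i
  proof (cases "i = n")
    case False
    then show ?thesis
      using that f(2)[of i] ab(1,3)[of i] by fastforce
  qed (use p w in simp)
  have "poincare_dist (\<phi> (p 0)) (\<phi> (p n)) \<le> (\<Sum>i<n. poincare_dist (\<phi> (p i)) (\<phi> (p (Suc i))))"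
    using p\<Omega> \<phi> by (intro poincare_dist_chain[where q = "\<lambda>i. \<phi> (p i)"]) auto
  also have "\<dots> \<le> s"
    unfolding s
  proof (rule sum_mono)
    fix i assume "i \<in> {..<n}"
    then have i: "i < n" by simp
    have "poincare_dist ((\<phi> \<circ> f i) (a i)) ((\<phi> \<circ> f i) (b i)) \<le> poincare_dist (a i) (b i)"
    proof (rule poincare_dist_contraction)
      show "\<phi> \<circ> f i holomorphic_on ball 0 1"
        using f i hol\<phi> by (intro holomorphic_on_compose_gen) auto
      show "(\<phi> \<circ> f i) ` ball 0 1 \<subseteq> ball 0 1"
        using f(2)[OF i] \<phi> by auto
    qed (use ab i in auto)
    then show "poincare_dist (\<phi> (p i)) (\<phi> (p (Suc i))) \<le> poincare_dist (a i) (b i)"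
      using ab i by simp
  qed
  finally show "poincare_dist (\<phi> z) (\<phi> w) \<le> s"
    using p by simp
qed

section \<open>Horofunctions of the disc\<close>

text \<open>For \<sigma> on the unit circle this is the Busemann function of the disc at \<sigma>,
  normalised to vanish at 0: minus one half of the logarithm of the Poisson kernel. Its sublevel
  sets are the horodiscs at \<sigma>.\<close>

definition horofunction :: "complex \<Rightarrow> complex \<Rightarrow> real" where
  "horofunction \<sigma> a = ln ((cmod (\<sigma> - a))\<^sup>2 / (1 - (cmod a)\<^sup>2)) / 2"

lemma horofunction_less_iff:
  assumes "cmod \<sigma> = 1" "cmod a < 1" "R > 0"
  shows "horofunction \<sigma> a < ln R / 2 \<longleftrightarrow> (cmod (\<sigma> - a))\<^sup>2 < R * (1 - (cmod a)\<^sup>2)"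
proof -
  have "\<sigma> \<noteq> a" "(cmod a)\<^sup>2 < 1" using assms by (auto simp: abs_square_less_1)
  then show ?thesis
    using assms by (simp add: horofunction_def divide_simps)
qed

text \<open>At distance \<open>t\<close> from \<sigma> on the radius, the squared distance is
  \<open>t * t\<close>, while 1 minus the squared modulus is \<open>t * (2 - t)\<close>, hence at
  least \<open>t\<close>. So \<open>t < R\<close> suffices.\<close>

lemma horofunction_radial:
  assumes "cmod \<sigma> = 1" "R > 0"
  shows "\<forall>\<^sub>F n in sequentially. horofunction \<sigma> (of_real (1 - inverse (real (Suc n))) * \<sigma>) < ln R / 2"
proof -
  have "(\<lambda>n. inverse (real (Suc n))) \<longlonglongrightarrow> 0"
    by (rule LIMSEQ_inverse_real_of_nat)
  then have "\<forall>\<^sub>F n in sequentially. inverse (real (Suc n)) < R"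
    using assms(2) by (rule order_tendstoD)
  then show ?thesis
  proof eventually_elim
    case (elim n)
    define t where "t = inverse (real (Suc n))"
    have t: "0 < t" "t \<le> 1" "t < R" using elim by (auto simp: t_def divide_simps)
    have "\<sigma> - of_real (1 - t) * \<sigma> = of_real t * \<sigma>" by (simp add: algebra_simps)
    then have 1: "cmod (\<sigma> - of_real (1 - t) * \<sigma>) = t"
      using assms t by (simp add: norm_mult)
    have 2: "cmod (of_real (1 - t) * \<sigma>) = 1 - t"
      using assms t by (simp only: norm_mult norm_of_real) simp
    have "t\<^sup>2 < R * t" using t by (simp add: power2_eq_square)
    also have "\<dots> \<le> R * (1 - (1 - t)\<^sup>2)"
      using t assms(2) by (intro mult_left_mono) (auto simp: power2_eq_square algebra_simps)
    finally show ?case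
      unfolding t_def[symmetric]
      using t assms 1 2 by (subst horofunction_less_iff) auto
  qed
qed

text \<open>Writing artanh r as ln (1 + r) minus half of ln (1 - r * r) isolates the part that blows
  up at the circle. That part depends on \<open>b\<close> through a factor that cancels in
  differences of distances.\<close>

lemma poincare_dist_eq_ln:
  assumes a: "cmod a < 1" and b: "cmod b < 1"
  shows "poincare_dist a b = ln (1 + cmod (Moebius_function 0 a b))
    + ln ((cmod (1 - cnj a * b))\<^sup>2 / ((1 - (cmod a)\<^sup>2) * (1 - (cmod b)\<^sup>2))) / 2"
proof -
  define r where "r = cmod (Moebius_function 0 a b)"
  have r: "0 \<le> r" "r < 1" using assms by (auto simp: r_def Moebius_function_norm_lt_1)
  then have r2: "r\<^sup>2 < 1" by (simp add: abs_square_less_1)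
  have "(1 + r) / (1 - r) = (1 + r)\<^sup>2 * inverse (1 - r\<^sup>2)"
    using r r2 by (simp add: divide_simps) (simp add: power2_eq_square algebra_simps)
  then have "ln ((1 + r) / (1 - r)) = 2 * ln (1 + r) + ln (inverse (1 - r\<^sup>2))"
    using r r2 by (simp add: ln_mult_pos ln_realpow)
  moreover have "inverse (1 - r\<^sup>2) = (cmod (1 - cnj a * b))\<^sup>2 / ((1 - (cmod a)\<^sup>2) * (1 - (cmod b)\<^sup>2))"
    using one_minus_norm_Moebius_power2[OF assms] by (simp add: r_def inverse_eq_divide)
  ultimately show ?thesis
    unfolding poincare_dist_eq_Moebius artanh_def r_def[symmetric] by simp
qed

lemma poincare_dist_diff_tendsto_horofunction:
  assumes f: "(f \<longlongrightarrow> \<sigma>) F" and ev: "\<forall>\<^sub>F w in F. cmod (f w) < 1"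
    and \<sigma>: "cmod \<sigma> = 1" and a: "cmod a < 1"
  shows "((\<lambda>w. poincare_dist a (f w) - poincare_dist 0 (f w)) \<longlongrightarrow> horofunction \<sigma> a) F"
proof -
  \<comment> \<open>This is the difference of distances with the singular factor in \<open>b\<close>
    cancelled, so it is continuous at \<sigma>. There the first two logarithms are both ln
    2.\<close>
  let ?g = "\<lambda>b. ln (1 + cmod (a - b) / cmod (1 - cnj a * b)) - ln (1 + cmod b)
      + ln ((cmod (1 - cnj a * b))\<^sup>2 / (1 - (cmod a)\<^sup>2)) / 2"
  have a2: "(cmod a)\<^sup>2 < 1" using a by (simp add: abs_square_less_1)
  have nz: "1 - cnj a * \<sigma> \<noteq> 0"
    using one_minus_cnj_mult_nonzero a \<sigma> by simp
  have eq: "cmod (1 - cnj a * \<sigma>) = cmod (\<sigma> - a)"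
    using norm_one_minus_cnj_mult_diff[of a \<sigma>] \<sigma>
    by (simp add: norm_minus_commute)
  have "((\<lambda>w. ?g (f w)) \<longlongrightarrow> ?g \<sigma>) F"
    using nz a2 f by (intro tendsto_intros) (auto simp: add_pos_nonneg add_nonneg_eq_0_iff)
  also have "?g \<sigma> = horofunction \<sigma> a"
    using nz eq \<sigma> a by (auto simp: horofunction_def norm_minus_commute)
  finally show ?thesis
  proof (rule Lim_transform_eventually)
    show "\<forall>\<^sub>F w in F. ?g (f w) = poincare_dist a (f w) - poincare_dist 0 (f w)"
      using ev
    proof eventually_elim
      case (elim w)
      have "(cmod (f w))\<^sup>2 < 1" using elim by (simp add: abs_square_less_1)
      moreover have "1 - cnj a * f w \<noteq> 0"
        using one_minus_cnj_mult_nonzero a elim by simp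
      ultimately show ?case
        using a2 elim a
        by (simp add: poincare_dist_eq_ln Moebius_function_0_eq ln_div ln_mult_pos)
          (simp add: diff_divide_distrib add_divide_distrib)
    qed
  qed
qed

section \<open>Sequential bounds for limits inferior and superior\<close>

text \<open>Approaching along one path bounds the lower limit from above; the dual lemma bounds the
  upper limit from below. Both are used for sequences that realise a cluster value.\<close>

lemma Liminf_le_of_tendsto_compose:
  fixes g :: "'a \<Rightarrow> 'b :: {complete_linorder, linorder_topology}"
  assumes "filterlim w F G" "((\<lambda>n. g (w n)) \<longlongrightarrow> l) G" "G \<noteq> bot"
  shows "Liminf F g \<le> l"
proof (rule Liminf_least)
  fix P assume "eventually P F"
  then have "\<forall>\<^sub>F n in G. P (w n)"
    using assms(1) by (simp add: filterlim_iff)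
  then have "\<forall>\<^sub>F n in G. (INF x\<in>Collect P. g x) \<le> g (w n)"
    by eventually_elim (auto intro: INF_lower)
  then show "(INF x\<in>Collect P. g x) \<le> l"
    using assms(2,3) by (intro tendsto_lowerbound)
qed

lemma Limsup_ge_of_tendsto_compose:
  fixes g :: "'a \<Rightarrow> 'b :: {complete_linorder, linorder_topology}"
  assumes "filterlim w F G" "((\<lambda>n. g (w n)) \<longlongrightarrow> l) G" "G \<noteq> bot"
  shows "l \<le> Limsup F g"
proof (rule Limsup_greatest)
  fix P assume "eventually P F"
  then have "\<forall>\<^sub>F n in G. P (w n)"
    using assms(1) by (simp add: filterlim_iff)
  then have "\<forall>\<^sub>F n in G. g (w n) \<le> (SUP x\<in>Collect P. g x)"
    by eventually_elim (auto intro: SUP_upper)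
  then show "l \<le> (SUP x\<in>Collect P. g x)"
    using assms(2,3) by (intro tendsto_upperbound)
qed

section \<open>Horospheres and boundary clusters of a Riemann map\<close>

text \<open>Here \<phi> is the inverse of \<psi>. It is assumed to be a left inverse; being a right
  inverse on \<Omega> follows from \<open>image_\<psi>\<close>.\<close>

locale riemann_map =
  fixes \<Omega> :: "complex set" and \<psi> \<phi> :: "complex \<Rightarrow> complex"
  assumes open_\<Omega>: "open \<Omega>" and bounded_\<Omega>: "bounded \<Omega>"
    and holomorphic_\<psi>: "\<psi> holomorphic_on ball 0 1" and image_\<psi>: "\<psi> ` ball 0 1 = \<Omega>"
    and holomorphic_\<phi>: "\<phi> holomorphic_on \<Omega>"
    and \<phi>_\<psi>: "\<And>\<xi>. cmod \<xi> < 1 \<Longrightarrow> \<phi> (\<psi> \<xi>) = \<xi>"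
begin

lemma norm_\<phi>: "z \<in> \<Omega> \<Longrightarrow> cmod (\<phi> z) < 1"
  using image_\<psi> \<phi>_\<psi> by auto

lemma \<psi>_\<phi>: "z \<in> \<Omega> \<Longrightarrow> \<psi> (\<phi> z) = z"
  using image_\<psi> \<phi>_\<psi> by auto

lemma \<psi>_in: "cmod \<xi> < 1 \<Longrightarrow> \<psi> \<xi> \<in> \<Omega>"
  using image_\<psi> by auto

lemma frontier_eq: "frontier \<Omega> = closure \<Omega> - \<Omega>"
  by (simp add: frontier_def interior_open open_\<Omega>)

text \<open>The pole \<psi> 0 corresponds to 0 in the disc. The filter is arbitrary so that the
  limit can be taken along a sequence as well as along all of \<Omega> near a frontier
  point.\<close>

lemma kobayashi_dist_diff_tendsto:
  assumes "((\<lambda>n. \<phi> (w n)) \<longlongrightarrow> \<sigma>) F" "\<forall>\<^sub>F n in F. w n \<in> \<Omega>" "cmod \<sigma> = 1" "z \<in> \<Omega>"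
  shows "((\<lambda>n. ereal (kobayashi_dist \<Omega> z (w n) - kobayashi_dist \<Omega> (\<psi> 0) (w n)))
    \<longlongrightarrow> ereal (horofunction \<sigma> (\<phi> z))) F"
proof (intro tendsto_intros)
  have "\<forall>\<^sub>F n in F. cmod (\<phi> (w n)) < 1"
    using assms(2) by eventually_elim (rule norm_\<phi>)
  then have "((\<lambda>n. poincare_dist (\<phi> z) (\<phi> (w n)) - poincare_dist 0 (\<phi> (w n)))
      \<longlongrightarrow> horofunction \<sigma> (\<phi> z)) F"
    using assms norm_\<phi> by (intro poincare_dist_diff_tendsto_horofunction)
  then show "((\<lambda>n. kobayashi_dist \<Omega> z (w n) - kobayashi_dist \<Omega> (\<psi> 0) (w n))
      \<longlongrightarrow> horofunction \<sigma> (\<phi> z)) F"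
  proof (rule Lim_transform_eventually)
    show "\<forall>\<^sub>F n in F. poincare_dist (\<phi> z) (\<phi> (w n)) - poincare_dist 0 (\<phi> (w n))
        = kobayashi_dist \<Omega> z (w n) - kobayashi_dist \<Omega> (\<psi> 0) (w n)"
      using assms(2)
    proof eventually_elim
      case (elim n)
      have eq: "kobayashi_dist \<Omega> u (w n) = poincare_dist (\<phi> u) (\<phi> (w n))" if "u \<in> \<Omega>" for u
        using holomorphic_\<psi> image_\<psi> holomorphic_\<phi> \<phi>_\<psi> that elim
        by (rule kobayashi_dist_eq_poincare_dist)
      show ?case
        using eq[OF assms(4)] eq[OF \<psi>_in[of 0]] \<phi>_\<psi>[of 0] by simp
    qed
  qed
qed

section \<open>The closure of the graph of \<phi>\<close>

text \<open>For \<open>x\<close> in the frontier, the points \<open>(x, \<sigma>)\<close> of this set record the cluster values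
  \<open>\<sigma>\<close> of \<open>\<phi>\<close> at \<open>x\<close>.\<close>
definition cluster_graph :: "(complex \<times> complex) set" where
  "cluster_graph = closure ((\<lambda>z. (z, \<phi> z)) ` \<Omega>)"

lemma cluster_graphE:
  assumes "(x, \<sigma>) \<in> cluster_graph"
  obtains w where "\<And>n. w n \<in> \<Omega>" "w \<longlonglongrightarrow> x" "(\<lambda>n. \<phi> (w n)) \<longlonglongrightarrow> \<sigma>"
proof -
  obtain p where p: "\<And>n. p n \<in> (\<lambda>z. (z, \<phi> z)) ` \<Omega>" "p \<longlonglongrightarrow> (x, \<sigma>)"
    using assms unfolding cluster_graph_def closure_sequential by blast
  show thesis
  proof (rule that[of "\<lambda>n. fst (p n)"])
    show "fst (p n) \<in> \<Omega>" for n
      using p(1)[of n] by auto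
    show "(\<lambda>n. fst (p n)) \<longlonglongrightarrow> x"
      using tendsto_fst[OF p(2)] by simp
    have "\<phi> (fst (p n)) = snd (p n)" for n
      using p(1)[of n] by auto
    then show "(\<lambda>n. \<phi> (fst (p n))) \<longlonglongrightarrow> \<sigma>"
      using tendsto_snd[OF p(2)] by simp
  qed
qed

lemma graph_in_cluster_graph: "z \<in> \<Omega> \<Longrightarrow> (z, \<phi> z) \<in> cluster_graph"
  unfolding cluster_graph_def by (intro closure_subset[THEN subsetD] imageI)

text \<open>Over \<Omega>, continuity of \<phi> leaves only the graph itself. Off \<Omega>, a value
  \<sigma> inside the disc is impossible, since continuity of \<psi> would give
  \<open>x = \<psi> \<sigma>\<close>, a point of \<Omega>.\<close>

lemma cluster_graph_cases:
  assumes "(x, \<sigma>) \<in> cluster_graph"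
  obtains "x \<in> \<Omega>" "\<sigma> = \<phi> x" | "x \<in> frontier \<Omega>" "cmod \<sigma> = 1"
proof -
  obtain w where w: "\<And>n. w n \<in> \<Omega>" "w \<longlonglongrightarrow> x" "(\<lambda>n. \<phi> (w n)) \<longlonglongrightarrow> \<sigma>"
    using assms cluster_graphE by blast
  show thesis
  proof (cases "x \<in> \<Omega>")
    case True
    then have "(\<lambda>n. \<phi> (w n)) \<longlonglongrightarrow> \<phi> x"
      using holomorphic_on_imp_continuous_on[OF holomorphic_\<phi>] w
      by (auto simp: continuous_on_sequentially o_def)
    then show thesis
      using True w(3) that(1) LIMSEQ_unique by blast
  next
    case False
    have "x \<in> closure \<Omega>"
      using w unfolding closure_sequential by blast
    then have fr: "x \<in> frontier \<Omega>"
      using False frontier_eq by blast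
    have le: "cmod \<sigma> \<le> 1"
      using w(1) norm_\<phi> by (intro LIMSEQ_le_const2[OF tendsto_norm[OF w(3)]]) (force intro: less_imp_le)
    have "\<not> cmod \<sigma> < 1"
    proof
      assume "cmod \<sigma> < 1"
      then have "(\<lambda>n. \<psi> (\<phi> (w n))) \<longlonglongrightarrow> \<psi> \<sigma>"
        using holomorphic_on_imp_continuous_on[OF holomorphic_\<psi>] w norm_\<phi>
        by (auto simp: continuous_on_sequentially o_def)
      then have "x = \<psi> \<sigma>"
        using w \<psi>_\<phi> LIMSEQ_unique by simp
      then show False
        using False \<psi>_in \<open>cmod \<sigma> < 1\<close> by blast
    qed
    then show thesis
      using le fr that(2) by simp
  qed
qed

lemma compact_cluster_graph: "compact cluster_graph"
proof -
  have "(\<lambda>z. (z, \<phi> z)) ` \<Omega> \<subseteq> \<Omega> \<times> ball 0 1"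
    using norm_\<phi> by auto
  then have "bounded ((\<lambda>z. (z, \<phi> z)) ` \<Omega>)"
    by (rule bounded_subset[OF bounded_Times[OF bounded_\<Omega> bounded_ball]])
  then show ?thesis
    unfolding cluster_graph_def by (simp add: compact_closure)
qed

text \<open>The projection of a compact set is closed, and it contains \<Omega>; the second
  projection is handled alike with the open disc.\<close>

lemma fst_cluster_graph: "fst ` cluster_graph = closure \<Omega>"
proof
  show "fst ` cluster_graph \<subseteq> closure \<Omega>"
    using closure_subset by (force elim!: cluster_graph_cases simp: frontier_eq)
  have "closed (fst ` cluster_graph)"
    by (intro compact_imp_closed compact_continuous_image compact_cluster_graph continuous_intros)
  moreover have "\<Omega> \<subseteq> fst ` cluster_graph"
    using graph_in_cluster_graph by force
  ultimately show "closure \<Omega> \<subseteq> fst ` cluster_graph"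
    by (simp add: closure_minimal)
qed

lemma snd_cluster_graph: "snd ` cluster_graph = cball 0 1"
proof
  show "snd ` cluster_graph \<subseteq> cball 0 1"
    using norm_\<phi> by (force elim!: cluster_graph_cases)
  have "closed (snd ` cluster_graph)"
    by (intro compact_imp_closed compact_continuous_image compact_cluster_graph continuous_intros)
  moreover have "ball 0 1 \<subseteq> snd ` cluster_graph"
  proof
    fix \<xi> :: complex assume "\<xi> \<in> ball 0 1"
    then have "(\<psi> \<xi>, \<xi>) \<in> cluster_graph"
      using graph_in_cluster_graph[OF \<psi>_in, of \<xi>] \<phi>_\<psi> by simp
    then show "\<xi> \<in> snd ` cluster_graph" by force
  qed
  ultimately have "closure (ball 0 1) \<subseteq> snd ` cluster_graph"
    by (simp only: closure_minimal)
  then show "cball 0 1 \<subseteq> snd ` cluster_graph"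
    by simp
qed

lemma cluster_filterlim:
  assumes "x \<in> frontier \<Omega>" "\<And>n. w n \<in> \<Omega>" "w \<longlonglongrightarrow> x"
  shows "filterlim w (at x within \<Omega>) sequentially"
proof -
  have "w n \<noteq> x" for n
    using assms frontier_eq by blast
  then show ?thesis
    using assms by (simp add: filterlim_at)
qed

section \<open>Horospheres and cluster values\<close>

text \<open>The upper limit dominates the limit along a sequence realising \<sigma>, which is the
  horofunction. Dually, the lower limit gives \<open>horofunction_big_horosphere\<close>.\<close>

lemma small_horosphere_horofunction:
  assumes "(x, \<sigma>) \<in> cluster_graph" "x \<in> frontier \<Omega>" "cmod \<sigma> = 1"
    "z \<in> small_horosphere \<Omega> (\<psi> 0) x R"
  shows "horofunction \<sigma> (\<phi> z) < ln R / 2"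
proof -
  obtain w where w: "\<And>n. w n \<in> \<Omega>" "w \<longlonglongrightarrow> x" "(\<lambda>n. \<phi> (w n)) \<longlonglongrightarrow> \<sigma>"
    using assms(1) cluster_graphE by blast
  have z: "z \<in> \<Omega>" and less: "Limsup (at x within \<Omega>)
      (\<lambda>w. ereal (kobayashi_dist \<Omega> z w - kobayashi_dist \<Omega> (\<psi> 0) w)) < ereal (ln R / 2)"
    using assms(4) by (auto simp: small_horosphere_def)
  have "ereal (horofunction \<sigma> (\<phi> z))
      \<le> Limsup (at x within \<Omega>) (\<lambda>w. ereal (kobayashi_dist \<Omega> z w - kobayashi_dist \<Omega> (\<psi> 0) w))"
    using w assms z
    by (intro Limsup_ge_of_tendsto_compose[where w = w and G = sequentially]
        kobayashi_dist_diff_tendsto cluster_filterlim) auto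
  with less have "ereal (horofunction \<sigma> (\<phi> z)) < ereal (ln R / 2)"
    by (rule order_le_less_trans[rotated])
  then show ?thesis by simp
qed

lemma horofunction_big_horosphere:
  assumes "(x, \<sigma>) \<in> cluster_graph" "x \<in> frontier \<Omega>" "cmod \<sigma> = 1"
    "z \<in> \<Omega>" "horofunction \<sigma> (\<phi> z) < ln R / 2"
  shows "z \<in> big_horosphere \<Omega> (\<psi> 0) x R"
proof -
  obtain w where w: "\<And>n. w n \<in> \<Omega>" "w \<longlonglongrightarrow> x" "(\<lambda>n. \<phi> (w n)) \<longlonglongrightarrow> \<sigma>"
    using assms(1) cluster_graphE by blast
  have "Liminf (at x within \<Omega>) (\<lambda>w. ereal (kobayashi_dist \<Omega> z w - kobayashi_dist \<Omega> (\<psi> 0) w))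
      \<le> ereal (horofunction \<sigma> (\<phi> z))"
    using w assms
    by (intro Liminf_le_of_tendsto_compose[where w = w and G = sequentially]
        kobayashi_dist_diff_tendsto cluster_filterlim) auto
  also have "\<dots> < ereal (ln R / 2)"
    using assms by simp
  finally show ?thesis
    using assms by (simp add: big_horosphere_def)
qed

text \<open>In the horodisc inequality the factor \<open>1 - (cmod (\<phi> z))\<^sup>2\<close> is at
  most 1.\<close>

lemma norm_diff_less_of_small_horosphere:
  assumes "(x, \<sigma>) \<in> cluster_graph" "x \<in> frontier \<Omega>" "cmod \<sigma> = 1" "e > 0"
    "z \<in> small_horosphere \<Omega> (\<psi> 0) x (e\<^sup>2)"
  shows "cmod (\<sigma> - \<phi> z) < e"
proof -
  have z: "z \<in> \<Omega>"
    using assms(5) by (simp add: small_horosphere_def)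
  have "(cmod (\<sigma> - \<phi> z))\<^sup>2 < e\<^sup>2 * (1 - (cmod (\<phi> z))\<^sup>2)"
    using small_horosphere_horofunction[OF assms(1-3,5)] horofunction_less_iff norm_\<phi>[OF z] assms
    by simp
  also have "\<dots> \<le> e\<^sup>2 * 1"
    by (intro mult_left_mono) auto
  finally show ?thesis
    using assms(4) by (simp add: power2_less_imp_less)
qed

text \<open>A single point of a small horosphere is mapped close to both cluster values at once, so
  these are arbitrarily close to each other.\<close>

lemma inj_on_fst_cluster_graph:
  assumes "\<And>x R. x \<in> frontier \<Omega> \<Longrightarrow> R > 0 \<Longrightarrow> small_horosphere \<Omega> (\<psi> 0) x R \<noteq> {}"
  shows "inj_on fst cluster_graph"
proof -
  have "\<sigma> = \<tau>" if \<sigma>: "(x, \<sigma>) \<in> cluster_graph" and \<tau>: "(x, \<tau>) \<in> cluster_graph" for x \<sigma> \<tau>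
  proof (cases "x \<in> \<Omega>")
    case True
    then show ?thesis
      using \<sigma> \<tau> frontier_eq by (auto elim!: cluster_graph_cases)
  next
    case False
    then have x: "x \<in> frontier \<Omega>" "cmod \<sigma> = 1" "cmod \<tau> = 1"
      using \<sigma> \<tau> by (auto elim: cluster_graph_cases)
    have "dist \<sigma> \<tau> < e" if e: "e > 0" for e
    proof -
      obtain z where z: "z \<in> small_horosphere \<Omega> (\<psi> 0) x ((e/2)\<^sup>2)"
        using assms[OF x(1), of "(e/2)\<^sup>2"] e by force
      then have "dist \<sigma> (\<phi> z) < e/2" "dist \<tau> (\<phi> z) < e/2"
        using norm_diff_less_of_small_horosphere[OF _ x(1) _ _ z] \<sigma> \<tau> x e
        by (auto simp: dist_norm)
      then show ?thesis
        by (rule dist_triangle_half_l)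
    qed
    then show ?thesis
      by (metis dist_pos_lt less_irrefl)
  qed
  then show ?thesis
    by (force simp: inj_on_def)
qed

text \<open>Radial points eventually enter the horodisc. By compactness their graph points
  subconverge to a point over \<sigma>, whose first coordinate is a frontier point because \<sigma>
  has modulus 1.\<close>

lemma cluster_point_of_horodisc:
  assumes "cmod \<sigma> = 1" "R > 0"
  obtains p where "p \<in> closure {z \<in> \<Omega>. horofunction \<sigma> (\<phi> z) < ln R / 2}" "p \<in> frontier \<Omega>"
proof -
  define \<xi> where "\<xi> n = of_real (1 - inverse (real (Suc n))) * \<sigma>" for n
  have \<xi>1: "cmod (\<xi> n) < 1" for n
  proof -
    have "cmod (\<xi> n) = \<bar>1 - inverse (real (Suc n))\<bar>"
      unfolding \<xi>_def norm_mult norm_of_real assms(1) by simp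
    also have "\<dots> < 1" by (simp add: divide_simps)
    finally show ?thesis .
  qed
  have "(\<lambda>n. of_real (1 - inverse (real (Suc n))) * \<sigma>) \<longlonglongrightarrow> of_real (1 - 0) * \<sigma>"
    by (intro tendsto_intros LIMSEQ_inverse_real_of_nat)
  then have \<xi>lim: "\<xi> \<longlonglongrightarrow> \<sigma>" by (simp add: \<xi>_def[abs_def])
  have "\<forall>n. (\<psi> (\<xi> n), \<xi> n) \<in> cluster_graph"
    using graph_in_cluster_graph[OF \<psi>_in[OF \<xi>1]] \<phi>_\<psi>[OF \<xi>1] by simp
  then obtain l r where l: "l \<in> cluster_graph" and r: "strict_mono r"
    and lim: "((\<lambda>n. (\<psi> (\<xi> n), \<xi> n)) \<circ> r) \<longlonglongrightarrow> l"
    using seq_compactE[OF compact_imp_seq_compact[OF compact_cluster_graph],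
        of "\<lambda>n. (\<psi> (\<xi> n), \<xi> n)"] by metis
  have "(\<lambda>n. \<xi> (r n)) \<longlonglongrightarrow> snd l"
    using tendsto_snd[OF lim] by (simp add: o_def)
  moreover have "(\<lambda>n. \<xi> (r n)) \<longlonglongrightarrow> \<sigma>"
    using LIMSEQ_subseq_LIMSEQ[OF \<xi>lim r] by (simp add: o_def)
  ultimately have "snd l = \<sigma>"
    by (rule LIMSEQ_unique)
  then have "(fst l, \<sigma>) \<in> cluster_graph"
    using l by auto
  then have "fst l \<in> frontier \<Omega>"
    using assms(1) norm_\<phi> by (force elim: cluster_graph_cases)
  moreover have "fst l \<in> closure {z \<in> \<Omega>. horofunction \<sigma> (\<phi> z) < ln R / 2}"
  proof (rule Lim_in_closed_set[of _ "\<lambda>n. \<psi> (\<xi> (r n))" sequentially])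
    have "\<forall>\<^sub>F n in sequentially. horofunction \<sigma> (\<xi> n) < ln R / 2"
      unfolding \<xi>_def by (rule horofunction_radial[OF assms])
    then have "\<forall>\<^sub>F n in sequentially. horofunction \<sigma> (\<xi> (r n)) < ln R / 2"
      using r by (rule eventually_subseq[rotated])
    then show "\<forall>\<^sub>F n in sequentially. \<psi> (\<xi> (r n)) \<in> closure {z \<in> \<Omega>. horofunction \<sigma> (\<phi> z) < ln R / 2}"
      by eventually_elim (use \<xi>1 \<psi>_in \<phi>_\<psi> closure_subset in force)
    show "(\<lambda>n. \<psi> (\<xi> (r n))) \<longlonglongrightarrow> fst l"
      using tendsto_fst[OF lim] by (simp add: o_def)
  qed auto
  ultimately show thesis
    using that by blast
qed

lemma inj_on_snd_cluster_graph:
  assumes big: "\<And>x R. x \<in> frontier \<Omega> \<Longrightarrow> R > 0 \<Longrightarrow>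
    closure (big_horosphere \<Omega> (\<psi> 0) x R) \<inter> frontier \<Omega> \<subseteq> {x}"
  shows "inj_on snd cluster_graph"
proof -
  have "x = y" if x: "(x, \<sigma>) \<in> cluster_graph" and y: "(y, \<sigma>) \<in> cluster_graph" for x y \<sigma>
  proof (cases "cmod \<sigma> < 1")
    case True
    then show ?thesis
      using x y \<psi>_\<phi> by (metis cluster_graph_cases less_irrefl)
  next
    case False
    then have fr: "x \<in> frontier \<Omega>" "y \<in> frontier \<Omega>" "cmod \<sigma> = 1"
      using x y norm_\<phi> by (auto elim!: cluster_graph_cases)
    \<comment> \<open>Any positive parameter would do; \<open>ln 1\<close> keeps the form required
      by the horosphere lemmas.\<close>
    let ?H = "{z \<in> \<Omega>. horofunction \<sigma> (\<phi> z) < ln 1 / 2}"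
    obtain p where p: "p \<in> closure ?H" "p \<in> frontier \<Omega>"
      using cluster_point_of_horodisc[OF fr(3), of 1] by auto
    have "?H \<subseteq> big_horosphere \<Omega> (\<psi> 0) x 1" "?H \<subseteq> big_horosphere \<Omega> (\<psi> 0) y 1"
      using horofunction_big_horosphere x y fr by blast+
    then have "p \<in> closure (big_horosphere \<Omega> (\<psi> 0) x 1)" "p \<in> closure (big_horosphere \<Omega> (\<psi> 0) y 1)"
      using p(1) closure_mono by blast+
    then show "x = y"
      using big[of x 1] big[of y 1] fr p(2) by auto
  qed
  then show ?thesis
    by (force simp: inj_on_def)
qed

section \<open>The two implications\<close>

text \<open>A continuous injection on a compact set is a homeomorphism onto its image, so \<Psi> can
  be taken as the inverse of the second projection followed by the first.\<close>

lemma homeomorphism_extension: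
  assumes hor: "\<And>x R. x \<in> frontier \<Omega> \<Longrightarrow> R > 0 \<Longrightarrow>
      closure (small_horosphere \<Omega> (\<psi> 0) x R) \<inter> frontier \<Omega> = {x} \<and>
      closure (big_horosphere \<Omega> (\<psi> 0) x R) \<inter> frontier \<Omega> = {x}"
  shows "\<exists>\<Psi> \<Psi>'. homeomorphism (cball 0 1) (closure \<Omega>) \<Psi> \<Psi>' \<and> (\<forall>z\<in>ball 0 1. \<Psi> z = \<psi> z)"
proof -
  have "inj_on fst cluster_graph"
    \<comment> \<open>A closure that contains \<open>x\<close> is the closure of a nonempty
      set.\<close>
    using hor by (intro inj_on_fst_cluster_graph) fastforce
  then obtain f' where f': "homeomorphism cluster_graph (closure \<Omega>) fst f'"
    using homeomorphism_compact[OF compact_cluster_graph continuous_on_fst[OF continuous_on_id] fst_cluster_graph]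
    by blast
  have "inj_on snd cluster_graph"
    using hor by (intro inj_on_snd_cluster_graph) blast
  then obtain s' where s': "homeomorphism cluster_graph (cball 0 1) snd s'"
    using homeomorphism_compact[OF compact_cluster_graph continuous_on_snd[OF continuous_on_id] snd_cluster_graph]
    by blast
  have "homeomorphism (cball 0 1) (closure \<Omega>) (fst \<circ> s') (snd \<circ> f')"
    using homeomorphism_compose[OF homeomorphism_symD[OF s'] f'] .
  moreover have "(fst \<circ> s') \<xi> = \<psi> \<xi>" if "\<xi> \<in> ball 0 1" for \<xi>
  proof -
    have "(\<psi> \<xi>, \<xi>) \<in> cluster_graph"
      using graph_in_cluster_graph[OF \<psi>_in, of \<xi>] \<phi>_\<psi> that by simp
    then have "s' \<xi> = (\<psi> \<xi>, \<xi>)"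
      using homeomorphism_apply1[OF s'] by fastforce
    then show ?thesis by simp
  qed
  ultimately show ?thesis by blast
qed

text \<open>Since \<phi> has a limit \<sigma> at \<open>x\<close>, the upper and lower limits agree
  and both horospheres are the preimage \<open>H\<close> of one horodisc. At a frontier point in its
  closure the right side of the horodisc inequality vanishes, which forces the value
  \<sigma>.\<close>

lemma horospheres_of_homeomorphism_extension:
  assumes hom: "homeomorphism (cball 0 1) (closure \<Omega>) \<Psi> \<Psi>'"
    and \<Psi>: "\<And>z. z \<in> ball 0 1 \<Longrightarrow> \<Psi> z = \<psi> z"
    and x: "x \<in> frontier \<Omega>" and R: "R > 0"
  shows "closure (small_horosphere \<Omega> (\<psi> 0) x R) \<inter> frontier \<Omega> = {x}"
    and "closure (big_horosphere \<Omega> (\<psi> 0) x R) \<inter> frontier \<Omega> = {x}"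
proof -
  have \<Psi>': "\<Psi>' z = \<phi> z" if "z \<in> \<Omega>" for z
    using homeomorphism_apply1[OF hom, of "\<phi> z"] \<Psi>[of "\<phi> z"] norm_\<phi>[OF that] \<psi>_\<phi>[OF that] by simp
  have cont: "continuous_on (closure \<Omega>) \<Psi>'"
    using hom homeomorphism_cont2 by blast
  have bdry: "cmod (\<Psi>' y) = 1" if "y \<in> frontier \<Omega>" for y
  proof -
    have y: "y \<in> closure \<Omega>" "y \<notin> \<Omega>" using that frontier_eq by auto
    then have "cmod (\<Psi>' y) \<le> 1"
      using homeomorphism_image2[OF hom] by force
    \<comment> \<open>Otherwise \<open>y = \<Psi> (\<Psi>' y) = \<psi> (\<Psi>' y)\<close> would lie
      in \<Omega>.\<close>
    moreover have "\<not> cmod (\<Psi>' y) < 1"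
      using homeomorphism_apply2[OF hom y(1)] \<Psi>[of "\<Psi>' y"] \<psi>_in[of "\<Psi>' y"] y(2) by auto
    ultimately show ?thesis by simp
  qed
  define \<sigma> where "\<sigma> = \<Psi>' x"
  have \<sigma>: "cmod \<sigma> = 1" using bdry x by (simp add: \<sigma>_def)
  have xcl: "x \<in> closure \<Omega>" "x \<notin> \<Omega>" using x frontier_eq by auto
  \<comment> \<open>A point of the closure outside \<Omega> is a limit point of \<Omega>; a
    nontrivial filter lets limits determine \<open>Limsup\<close> and \<open>Liminf\<close>.\<close>
  have nontriv: "at x within \<Omega> \<noteq> bot"
    using xcl by (auto simp: trivial_limit_within closure_def)
  define H where "H = {z \<in> \<Omega>. horofunction \<sigma> (\<phi> z) < ln R / 2}"
  have ev: "\<forall>\<^sub>F w in at x within \<Omega>. w \<in> \<Omega>"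
    by (simp add: eventually_at_filter)
  have "(\<Psi>' \<longlongrightarrow> \<sigma>) (at x within \<Omega>)"
    using cont xcl(1) closure_subset unfolding continuous_on_def \<sigma>_def
    by (meson tendsto_within_subset)
  then have "(\<phi> \<longlongrightarrow> \<sigma>) (at x within \<Omega>)"
    by (rule Lim_transform_eventually) (use ev \<Psi>' in \<open>auto elim: eventually_mono\<close>)
  then have lim: "((\<lambda>w. ereal (kobayashi_dist \<Omega> z w - kobayashi_dist \<Omega> (\<psi> 0) w))
    \<longlongrightarrow> ereal (horofunction \<sigma> (\<phi> z))) (at x within \<Omega>)" if "z \<in> \<Omega>" for z
    using kobayashi_dist_diff_tendsto[OF _ ev \<sigma> that] by blast
  have small: "small_horosphere \<Omega> (\<psi> 0) x R = H"
    unfolding small_horosphere_def H_def using lim_imp_Limsup[OF nontriv lim] by auto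
  have big: "big_horosphere \<Omega> (\<psi> 0) x R = H"
    unfolding big_horosphere_def H_def using lim_imp_Liminf[OF nontriv lim] by auto
  have "y = x" if y: "y \<in> closure H" "y \<in> frontier \<Omega>" for y
  proof -
    obtain z where z: "\<And>n. z n \<in> H" "z \<longlonglongrightarrow> y"
      using y(1) unfolding closure_sequential by blast
    have zO: "z n \<in> \<Omega>" for n using z(1)[of n] by (simp add: H_def)
    have ycl: "y \<in> closure \<Omega>" using y(2) frontier_eq by simp
    have "(\<lambda>n. \<Psi>' (z n)) \<longlonglongrightarrow> \<Psi>' y"
      using cont z(2) zO closure_subset[of \<Omega>] ycl
      by (auto simp: continuous_on_sequentially o_def)
    then have lim: "(\<lambda>n. \<phi> (z n)) \<longlonglongrightarrow> \<Psi>' y"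
      using \<Psi>' zO by simp
    have "(cmod (\<sigma> - \<Psi>' y))\<^sup>2 \<le> R * (1 - (cmod (\<Psi>' y))\<^sup>2)"
    proof (rule LIMSEQ_le)
      show "(\<lambda>n. (cmod (\<sigma> - \<phi> (z n)))\<^sup>2) \<longlonglongrightarrow> (cmod (\<sigma> - \<Psi>' y))\<^sup>2"
           "(\<lambda>n. R * (1 - (cmod (\<phi> (z n)))\<^sup>2)) \<longlonglongrightarrow> R * (1 - (cmod (\<Psi>' y))\<^sup>2)"
        using lim by (auto intro!: tendsto_intros)
      show "\<exists>N. \<forall>n\<ge>N. (cmod (\<sigma> - \<phi> (z n)))\<^sup>2 \<le> R * (1 - (cmod (\<phi> (z n)))\<^sup>2)"
        using z(1) horofunction_less_iff[OF \<sigma> norm_\<phi> R] by (auto simp: H_def intro: less_imp_le)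
    qed
    then have "\<Psi>' y = \<Psi>' x"
      using bdry[OF y(2)] by (simp add: \<sigma>_def)
    then show "y = x"
      using homeomorphism_apply2[OF hom] ycl xcl(1) by metis
  qed
  \<comment> \<open>So far \<open>x\<close> is the only candidate; the existence of some such
    \<open>p\<close> shows that \<open>x\<close> does occur.\<close>
  moreover obtain p where "p \<in> closure H" "p \<in> frontier \<Omega>"
    using cluster_point_of_horodisc[OF \<sigma> R] unfolding H_def by blast
  ultimately have "closure H \<inter> frontier \<Omega> = {x}"
    by blast
  then show "closure (small_horosphere \<Omega> (\<psi> 0) x R) \<inter> frontier \<Omega> = {x}"
    and "closure (big_horosphere \<Omega> (\<psi> 0) x R) \<inter> frontier \<Omega> = {x}"
    by (simp_all only: small big)
qed

end

theorem theorem1p1: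
  fixes \<Omega> :: "complex set" and \<psi> :: "complex \<Rightarrow> complex"
  assumes "open \<Omega>" and "connected \<Omega>" and "bounded \<Omega>" and "simply_connected \<Omega>"
    and "\<psi> holomorphic_on ball 0 1" and "inj_on \<psi> (ball 0 1)" and "\<psi> ` ball 0 1 = \<Omega>"
  shows "(\<forall>x\<in>frontier \<Omega>. \<forall>R>0.
            closure (small_horosphere \<Omega> (\<psi> 0) x R) \<inter> frontier \<Omega> = {x} \<and>
            closure (big_horosphere \<Omega> (\<psi> 0) x R) \<inter> frontier \<Omega> = {x})
     \<longleftrightarrow> (\<exists>\<Psi> \<Psi>'. homeomorphism (cball 0 1) (closure \<Omega>) \<Psi> \<Psi>' \<and>
            (\<forall>z\<in>ball 0 1. \<Psi> z = \<psi> z))"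
    (is "?lhs \<longleftrightarrow> ?rhs")
proof -
  obtain \<phi> where \<phi>: "\<phi> holomorphic_on \<psi> ` ball 0 1" "\<And>z. z \<in> ball 0 1 \<Longrightarrow> \<phi> (\<psi> z) = z"
    using holomorphic_has_inverse[OF assms(5) open_ball assms(6)] by blast
  interpret riemann_map \<Omega> \<psi> \<phi>
  proof
    show "open \<Omega>" "bounded \<Omega>" "\<psi> holomorphic_on ball 0 1" "\<psi> ` ball 0 1 = \<Omega>"
      by (rule assms)+
    show "\<phi> holomorphic_on \<Omega>"
      using \<phi>(1) unfolding assms(7) .
    show "\<phi> (\<psi> \<xi>) = \<xi>" if "cmod \<xi> < 1" for \<xi>
      using \<phi>(2) that by simp
  qed
  show ?thesis
  proof
    assume hor: ?lhs
    show ?rhs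
      by (rule homeomorphism_extension, rule hor[rule_format])
  next
    assume ?rhs
    then obtain \<Psi> \<Psi>' where hom: "homeomorphism (cball 0 1) (closure \<Omega>) \<Psi> \<Psi>'"
      and \<Psi>: "\<And>z. z \<in> ball 0 1 \<Longrightarrow> \<Psi> z = \<psi> z" by blast
    show ?lhs
      by (intro ballI allI impI conjI horospheres_of_homeomorphism_extension[OF hom \<Psi>])
  qed
qed

end
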